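(* Let $r\in\mathbb{N}$. The function $A:\mathbb{N}^r\to\mathbb{C}$ given by $$A(m_1,\ldots,m_r)= \frac1{m} \sum_{k=1}^m \gcd(k,m_1)\cdots \gcd(k,m_r),\qquad m=\operatorname{lcm}[m_1,\ldots,m_r],$$ is multiplicative as a function of $r$ variables.
   Context: $\mathbb{N}=\{1,2,\ldots\}$. A function $f:\mathbb{N}^r\to\mathbb{C}$ is called multiplicative (as a function of several variables) if it is not identically zero and $f(m_1n_1,\ldots,m_rn_r)=f(m_1,\ldots,m_r)f(n_1,\ldots,n_r)$ for all $m_1,\ldots,m_r,n_1,\ldots,n_r\in\mathbb{N}$ with $\gcd(m_1\cdots m_r,\,n_1\cdots n_r)=1$. *)

theory Defs
  imports Complex_Main
begin

text \<open>
  The \<open>r\<close>-tuple \<open>(n\<^sub>1, \<dots>, n\<^sub>r)\<close> of positive integers is the list \<open>[n\<^sub>1, \<dots>, n\<^sub>r]\<close>. A function on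
  tuples is a HOL function on all lists; its values outside \<open>pos_tuples r\<close> are irrelevant.
\<close>

definition pos_tuples :: "nat \<Rightarrow> nat list set" where
  "pos_tuples r = {ns. length ns = r \<and> (\<forall>n\<in>set ns. 1 \<le> n)}"

definition multiplicative_tuple_fun :: "nat \<Rightarrow> (nat list \<Rightarrow> complex) \<Rightarrow> bool" where
  "multiplicative_tuple_fun r f \<longleftrightarrow>
     (\<exists>ns\<in>pos_tuples r. f ns \<noteq> 0) \<and>
     (\<forall>ms\<in>pos_tuples r. \<forall>ns\<in>pos_tuples r.
        gcd (prod_list ms) (prod_list ns) = 1 \<longrightarrow>
        f (map2 (*) ms ns) = f ms * f ns)"

definition gcd_average :: "nat list \<Rightarrow> complex" where
  "gcd_average ms =
     (let m = Lcm (set ms)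
      in 1 / of_nat m * (\<Sum>k = 1..m. \<Prod>n\<leftarrow>ms. of_nat (gcd k n)))"

end

theory Submission
  imports Defs "HOL-Number_Theory.Cong"
begin

text \<open>
  The summand \<open>G\<^sub>m(k) = \<Prod>\<^sub>i gcd(k, m\<^sub>i)\<close> is periodic in \<open>k\<close> modulo any common multiple of the
  \<open>m\<^sub>i\<close>, and \<open>G\<^sub>m\<^sub>n = G\<^sub>m G\<^sub>n\<close> when the products of the entries are coprime, in which
  case the least common multiples multiply as well. So the sum over residues modulo
  \<open>lcm(m) lcm(n)\<close> splits by the Chinese remainder theorem.
\<close>

text \<open>A divisor of \<open>a * b\<close> factors as \<open>d * e\<close> with
  \<open>d dvd a\<close> and \<open>e dvd b\<close>, which gives one divisibility. For the other,
  \<open>gcd k a\<close> and \<open>gcd k b\<close> are coprime divisors of \<open>k\<close>, so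
  their product divides \<open>k\<close> as well as \<open>a * b\<close>.\<close>

lemma gcd_mult_coprime_right:
  fixes k a b :: "'a :: semiring_gcd_mult_normalize"
  assumes "coprime a b"
  shows "gcd k (a * b) = gcd k a * gcd k b"
proof (rule associated_eqI)
  obtain d e where de: "gcd k (a * b) = d * e" "d dvd a" "e dvd b"
    using division_decomp[of "gcd k (a * b)" a b] by auto
  then have "d dvd k" "e dvd k"
    by (metis dvd_mult_left dvd_mult_right gcd_dvd1)+
  with de show "gcd k (a * b) dvd gcd k a * gcd k b"
    by (simp add: mult_dvd_mono)
  show "gcd k a * gcd k b dvd gcd k (a * b)"
    using assms by (intro gcd_greatest mult_dvd_mono divides_mult) (auto intro: coprime_divisors)
qed (simp_all add: normalize_mult)

text \<open>Chinese remainder theorem: uniqueness gives injectivity, and surjectivity follows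
  because both sides have \<open>M * N\<close> elements.\<close>

lemma bij_betw_mod_mod:
  fixes M N :: nat
  assumes "coprime M N" "0 < M" "0 < N"
  shows "bij_betw (\<lambda>k. (k mod M, k mod N)) {..<M * N} ({..<M} \<times> {..<N})"
proof (rule bij_betw_imageI)
  show inj: "inj_on (\<lambda>k. (k mod M, k mod N)) {..<M * N}"
  proof (rule inj_onI)
    fix x y
    assume "x \<in> {..<M * N}" "y \<in> {..<M * N}" "(x mod M, x mod N) = (y mod M, y mod N)"
    then show "x = y"
      using coprime_cong_mult_nat[of x y M N] assms by (simp add: cong_def)
  qed
  show "(\<lambda>k. (k mod M, k mod N)) ` {..<M * N} = {..<M} \<times> {..<N}"
    using assms by (intro card_subset_eq) (auto simp: card_image[OF inj])
qed

lemma sum_mod_mult_coprime: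
  fixes f g :: "nat \<Rightarrow> 'a :: comm_semiring_0"
  assumes "coprime M N" "0 < M" "0 < N"
  shows "(\<Sum>k<M * N. f (k mod M) * g (k mod N)) = (\<Sum>i<M. f i) * (\<Sum>j<N. g j)"
  using sum.reindex_bij_betw[OF bij_betw_mod_mod[OF assms], of "\<lambda>(i, j). f i * g j"]
  by (simp add: sum_product sum.cartesian_product)

lemma Lcm_set_dvd_prod_list:
  fixes xs :: "nat list"
  shows "Lcm (set xs) dvd prod_list xs"
  by (auto intro: Lcm_least prod_list_dvd)

text \<open>Each entry of \<open>ms\<close> and of \<open>ns\<close> divides an entry of the product
  list, so both lcms divide the left side. They are coprime, as divisors of the coprime products,
  hence their product divides it too.\<close>

lemma Lcm_map2_mult_coprime:
  fixes ms ns :: "nat list"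
  assumes "length ms = length ns" "coprime (prod_list ms) (prod_list ns)"
  shows "Lcm (set (map2 (*) ms ns)) = Lcm (set ms) * Lcm (set ns)"
proof (rule dvd_antisym)
  show "Lcm (set (map2 (*) ms ns)) dvd Lcm (set ms) * Lcm (set ns)"
    by (auto intro!: Lcm_least mult_dvd_mono dvd_Lcm dest: set_zip_leftD set_zip_rightD)
  have "ms ! i * ns ! i dvd Lcm (set (map2 (*) ms ns))" if "i < length ms" for i
    using that assms by (auto intro!: dvd_Lcm simp: set_zip)
  then have "ms ! i dvd Lcm (set (map2 (*) ms ns))" "ns ! i dvd Lcm (set (map2 (*) ms ns))"
    if "i < length ms" for i
    using that by (blast intro: dvd_mult_left dvd_mult_right)+
  then have "Lcm (set ms) dvd Lcm (set (map2 (*) ms ns))"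
    "Lcm (set ns) dvd Lcm (set (map2 (*) ms ns))"
    using assms(1) by (auto intro!: Lcm_least simp del: set_map simp: in_set_conv_nth)
  moreover have "coprime (Lcm (set ms)) (Lcm (set ns))"
    using assms(2) Lcm_set_dvd_prod_list by (blast intro: coprime_divisors)
  ultimately show "Lcm (set ms) * Lcm (set ns) dvd Lcm (set (map2 (*) ms ns))"
    by (intro divides_mult)
qed

definition gcd_product :: "nat list \<Rightarrow> nat \<Rightarrow> nat" where
  "gcd_product ms k = (\<Prod>n\<leftarrow>ms. gcd k n)"

lemma gcd_product_map2_mult_coprime:
  assumes "length ms = length ns" "coprime (prod_list ms) (prod_list ns)"
  shows "gcd_product (map2 (*) ms ns) k = gcd_product ms k * gcd_product ns k"
  using assms
  by (induction ms ns rule: list_induct2) (auto simp: gcd_product_def gcd_mult_coprime_right)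

text \<open>\<open>gcd k n\<close> depends only on \<open>k mod n\<close>, and reducing modulo a
  multiple \<open>M\<close> of \<open>n\<close> preserves that residue.\<close>

lemma gcd_product_mod:
  assumes "\<And>n. n \<in> set ms \<Longrightarrow> n dvd M"
  shows "gcd_product ms (k mod M) = gcd_product ms k"
proof -
  have "gcd (k mod M) n = gcd k n" if "n \<in> set ms" for n
    using assms[OF that] by (metis gcd.commute gcd_red_nat mod_mod_cancel)
  then show ?thesis
    by (simp add: gcd_product_def cong: map_cong)
qed

lemma gcd_average_eq:
  "gcd_average ms =
    of_nat (\<Sum>k<Lcm (set ms). gcd_product ms k) / of_nat (Lcm (set ms))"
proof -
  let ?m = "Lcm (set ms)"
  \<comment> \<open>By periodicity the end terms agree, so the range from 1 to \<open>?m\<close> may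
    be replaced by the residues below \<open>?m\<close>.\<close>
  have "gcd_product ms ?m = gcd_product ms 0"
    using gcd_product_mod[of ms ?m ?m] by (simp add: dvd_Lcm)
  then have "(\<Sum>k=1..?m. gcd_product ms k) = (\<Sum>k<?m. gcd_product ms k)"
    using sum.lessThan_Suc_shift[of "gcd_product ms" ?m]
    by (simp add: sum.atLeast1_atMost_eq)
  moreover have "(\<Prod>n\<leftarrow>ms. of_nat (gcd k n)) = (of_nat (gcd_product ms k) :: complex)" for k
    unfolding gcd_product_def by (induction ms) auto
  ultimately show ?thesis
    by (simp add: gcd_average_def Let_def flip: of_nat_sum)
qed

lemma gcd_average_map2_mult:
  assumes ms: "ms \<in> pos_tuples r" and ns: "ns \<in> pos_tuples r"
    and coprime: "coprime (prod_list ms) (prod_list ns)"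
  shows "gcd_average (map2 (*) ms ns) = gcd_average ms * gcd_average ns"
proof -
  let ?M = "Lcm (set ms)" and ?N = "Lcm (set ns)"
  have len: "length ms = length ns"
    using ms ns by (simp add: pos_tuples_def)
  have "0 \<notin> set ms" "0 \<notin> set ns"
    using ms ns by (auto simp: pos_tuples_def)
  then have pos: "0 < ?M" "0 < ?N"
    by (simp_all add: Lcm_0_iff zero_less_iff_neq_zero)
  have "coprime ?M ?N"
    using coprime Lcm_set_dvd_prod_list by (blast intro: coprime_divisors)
  \<comment> \<open>Periodicity modulo \<open>?M\<close> and \<open>?N\<close> removes the
    reductions of \<open>k\<close> in the summand.\<close>
  from sum_mod_mult_coprime[OF this pos, of "gcd_product ms" "gcd_product ns"]
  have "(\<Sum>k<?M * ?N. gcd_product ms k * gcd_product ns k) =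
      (\<Sum>k<?M. gcd_product ms k) * (\<Sum>k<?N. gcd_product ns k)"
    by (simp add: gcd_product_mod dvd_Lcm)
  then show ?thesis
    by (simp del: set_map add: gcd_average_eq Lcm_map2_mult_coprime[OF len coprime]
      gcd_product_map2_mult_coprime[OF len coprime] flip: of_nat_mult of_nat_sum)
qed

theorem corollary13:
  fixes r :: nat
  assumes "1 \<le> r"
  shows "multiplicative_tuple_fun r gcd_average"
  unfolding multiplicative_tuple_fun_def
proof (intro conjI ballI impI)
  \<comment> \<open>At the all-ones tuple the lcm is 1 and the only summand is 1.\<close>
  have "replicate r 1 \<in> pos_tuples r"
    by (simp add: pos_tuples_def)
  moreover have "gcd_average (replicate r 1) = 1"
    using assms by (simp add: gcd_average_def map_replicate_const)
  ultimately show "\<exists>ns\<in>pos_tuples r. gcd_average ns \<noteq> 0"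
    by (metis zero_neq_one)
next
  fix ms ns
  assume "ms \<in> pos_tuples r" "ns \<in> pos_tuples r" "gcd (prod_list ms) (prod_list ns) = 1"
  then show "gcd_average (map2 (*) ms ns) = gcd_average ms * gcd_average ns"
    by (intro gcd_average_map2_mult) (simp_all add: coprime_iff_gcd_eq_1)
qed

end
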